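(* Fix $1\le\gamma<\sqrt e$ and for each $n$ put $\eta_n=n^{-1}$, $\kappa_n=n^{-1/n}$, $R_n=n^{1/n}$, $\rho_n=\gamma R_n$, $k=n/2$ and $\alpha_n=\sqrt{n/(2\pi)}/\mathrm{GH}_n$. Let $$M_{1,n}=\frac{P(k,\pi\rho_n^2\mathrm{GH}_n^2)-P(k,\pi\kappa_n^2\mathrm{GH}_n^2)}{\zeta(n)},\qquad M_{2,n}=\frac{n(k/e)^k}{\Gamma(k+1)}\,\frac{\zeta(n)-1}{\zeta(n)}\,\log\frac{\rho_n}{\kappa_n},$$ $$U_n=\min\{1,(M_{1,n}+M_{2,n})/\eta_n\},\qquad E_{+,n}=\eta_n+\frac{\kappa_n^n}{2\zeta(n)}+\frac{2\zeta(n)}{R_n^n}.$$ Then for all sufficiently large $n$ one has $0<\eta_n<1$, $0<\kappa_n<1<R_n$, $\alpha_n/2\le\kappa_n$ and $\rho_n\le\alpha_n$; moreover $E_{+,n}\to0$ and $$-\frac1n\log U_n\longrightarrow \frac{\gamma^2}{2e}-\log\gamma .$$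
   Context: All logarithms are natural; $\zeta$ is the Riemann zeta function, $P(k,x)=\frac1{\Gamma(k)}\int_0^x t^{k-1}e^{-t}\,dt$, $v_n$ is the volume of the Euclidean unit ball in $\mathbb R^n$, and $\mathrm{GH}_n=v_n^{-1/n}$. Limits are as $n\to\infty$. *)

theory Defs
  imports "HOL-Analysis.Analysis"
begin

(* Dirichlet series of the Riemann zeta function: meaningful for s > 1 only, the range
   in which it is used below (zeta at the integers n >= 2). *)
definition riemann_zeta :: "real \<Rightarrow> real" where
  "riemann_zeta s = (\<Sum>m. 1 / real (Suc m) powr s)"

definition P_gamma :: "real \<Rightarrow> real \<Rightarrow> real" where
  "P_gamma k x = (1 / Gamma k) * integral {0..x} (\<lambda>t. t powr (k - 1) * exp (- t))"

(* The library defines unit_ball_vol by its Gamma function formula. Since the dimension is a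
   variable here, this ties it to Lebesgue measure, with R^n as real families indexed by {..<n}
   (for type-indexed dimensions see content_ball). *)
lemma unit_ball_vol_eq_measure:
  "measure (Pi\<^sub>M {..<n} (\<lambda>_. lborel))
     ({x. sqrt (\<Sum>i<n. (x i)\<^sup>2) \<le> 1} \<inter> space (Pi\<^sub>M {..<n} (\<lambda>_. lborel)))
   = unit_ball_vol (real n)"
  using emeasure_cball_aux[of "{..<n}" 1] by (simp add: measure_def)

definition GH :: "nat \<Rightarrow> real" where
  "GH n = unit_ball_vol (real n) powr (- (1 / real n))"

definition eta_seq :: "nat \<Rightarrow> real" where
  "eta_seq n = 1 / real n"

definition kappa_seq :: "nat \<Rightarrow> real" where
  "kappa_seq n = real n powr (- (1 / real n))"

definition R_seq :: "nat \<Rightarrow> real" where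
  "R_seq n = real n powr (1 / real n)"

definition rho_seq :: "real \<Rightarrow> nat \<Rightarrow> real" where
  "rho_seq \<gamma> n = \<gamma> * R_seq n"

definition alpha_seq :: "nat \<Rightarrow> real" where
  "alpha_seq n = sqrt (real n / (2 * pi)) / GH n"

definition M1_seq :: "real \<Rightarrow> nat \<Rightarrow> real" where
  "M1_seq \<gamma> n = (let k = real n / 2 in
     (P_gamma k (pi * (rho_seq \<gamma> n)\<^sup>2 * (GH n)\<^sup>2) - P_gamma k (pi * (kappa_seq n)\<^sup>2 * (GH n)\<^sup>2))
       / riemann_zeta (real n))"

definition M2_seq :: "real \<Rightarrow> nat \<Rightarrow> real" where
  "M2_seq \<gamma> n = (let k = real n / 2 in
     (real n * (k / exp 1) powr k / Gamma (k + 1))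
       * ((riemann_zeta (real n) - 1) / riemann_zeta (real n))
       * ln (rho_seq \<gamma> n / kappa_seq n))"

definition U_seq :: "real \<Rightarrow> nat \<Rightarrow> real" where
  "U_seq \<gamma> n = min 1 ((M1_seq \<gamma> n + M2_seq \<gamma> n) / eta_seq n)"

definition E_plus_seq :: "nat \<Rightarrow> real" where
  "E_plus_seq n = eta_seq n + kappa_seq n ^ n / (2 * riemann_zeta (real n))
     + 2 * riemann_zeta (real n) / R_seq n ^ n"

end

theory Submission
  imports Defs "HOL-Real_Asymp.Real_Asymp"
begin

text \<open>
  Writing \<open>k = n/2\<close>, the quantity \<open>\<pi> GH\<^sub>n\<^sup>2 = \<Gamma>(k+1)\<^bsup>1/k\<^esup>\<close> is asymptotic to \<open>k/e\<close>, so the upper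
  limit \<open>x\<close> of the incomplete gamma integral in \<open>M\<^sub>1\<close> satisfies \<open>x/n \<longlonglongrightarrow> \<gamma>\<^sup>2/(2e) < 1/2\<close>. Hence the
  integrand is increasing up to \<open>x\<close>, and it is enough to evaluate it at the end of the interval: even
  for \<open>\<gamma> = 1\<close> the interval has length of order \<open>log n\<close>, so it contains \<open>[x-1, x]\<close>, which gives a
  lower bound with the same exponential rate as the trivial upper bound. The term \<open>M\<^sub>2\<close> is at most of
  order \<open>n 2\<^bsup>-n\<^esup>\<close>, which is negligible because the rate is at most \<open>1/(2e) < ln 2\<close>.
\<close>

section \<open>The error in Stirling's approximation of \<open>ln (Gamma (x + 1))\<close>\<close>

definition stirling_error :: "real \<Rightarrow> real" where
  "stirling_error x = ln (Gamma (x + 1)) - x * ln x + x"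

text \<open>The upper bound on the increment telescopes to a logarithm, so no form of Stirling's formula is
  needed beyond the values at \<open>1/2\<close> and \<open>1\<close>.\<close>

lemma stirling_error_step:
  assumes "x > 0"
  shows "stirling_error x \<le> stirling_error (x + 1)"
    and "stirling_error (x + 1) \<le> stirling_error x + (ln (x + 1) - ln x)"
proof -
  have G: "Gamma (x + 1) > 0" using assms by (intro Gamma_real_pos) auto
  have "Gamma (x + 1 + 1) = (x + 1) * Gamma (x + 1)"
    using assms by (intro Gamma_plus1) (auto elim!: nonpos_Ints_cases)
  then have "ln (Gamma (x + 1 + 1)) = ln (x + 1) + ln (Gamma (x + 1))"
    using G assms by (metis add_pos_pos ln_mult_pos zero_less_one)
  then have diff: "stirling_error (x + 1) - stirling_error x = 1 - x * (ln (x + 1) - ln x)"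
    unfolding stirling_error_def by (simp add: algebra_simps)
  \<comment> \<open>The increment is 1 - x d with d = \<open>ln (x + 1) - ln x\<close>, which lies
    between 1/(x + 1) and 1/x. The upper bound on d makes the increment nonnegative. The lower one,
    read as 1 \<le> (x + 1) d, gives 1 - x d \<le> d.\<close>
  have 1: "ln (x + 1) - ln x \<le> 1 / x"
    using ln_le_minus_one[of "(x + 1) / x"] assms by (simp add: ln_div field_simps)
  have 2: "1 / (x + 1) \<le> ln (x + 1) - ln x"
    using ln_le_minus_one[of "x / (x + 1)"] assms by (simp add: ln_div field_simps)
  have "x * (ln (x + 1) - ln x) \<le> 1"
    using mult_left_mono[OF 1, of x] assms by simp
  with diff show "stirling_error x \<le> stirling_error (x + 1)" by simp
  have "1 \<le> (x + 1) * (ln (x + 1) - ln x)"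
    using mult_left_mono[OF 2, of "x + 1"] assms by simp
  then have "1 - x * (ln (x + 1) - ln x) \<le> ln (x + 1) - ln x" by (simp add: algebra_simps)
  with diff show "stirling_error (x + 1) \<le> stirling_error x + (ln (x + 1) - ln x)" by simp
qed

text \<open>A unit step in x is a step of 2 in n = 2x, so the odd and the even n are two separate
  chains, starting at 1 and 2. Along each chain the increments are nonnegative and bounded by
  \<open>ln (n + 2) - ln n\<close>, which telescopes. The min and max of the two starting values
  serve both chains.\<close>

lemma stirling_error_half_bounds:
  obtains c C where "\<And>n. n \<ge> 1 \<Longrightarrow> c \<le> stirling_error (real n / 2)"
    and "\<And>n. n \<ge> 1 \<Longrightarrow> stirling_error (real n / 2) \<le> C + ln (real n)"
proof -
  define h where "h n = stirling_error (real n / 2)" for n :: nat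
  have step: "h n \<le> h (n + 2)" "h (n + 2) \<le> h n + (ln (real (n + 2)) - ln (real n))"
    if "n \<ge> 1" for n
  proof -
    have "real n / 2 + 1 = real (n + 2) / 2" by simp
    note step = stirling_error_step[of "real n / 2", unfolded this]
    have "ln (real (n + 2) / 2) - ln (real n / 2) = ln (real (n + 2)) - ln (real n)"
      using that by (simp add: ln_div)
    then show "h n \<le> h (n + 2)" "h (n + 2) \<le> h n + (ln (real (n + 2)) - ln (real n))"
      using step that unfolding h_def by simp_all
  qed
  have "min (h 1) (h 2) \<le> h n \<and> h n \<le> max (h 1) (h 2) + ln (real n)" if "n \<ge> 1" for n
    using that
  proof (induction n rule: less_induct)
    case (less n)
    have "n = 1 \<or> n = 2 \<or> n = (n - 2) + 2 \<and> n - 2 \<ge> 1" using less.prems by linarith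
    then consider "n = 1" | "n = 2" | m where "n = m + 2" "m \<ge> 1" by blast
    then show ?case
    proof cases
      case 3
      with less.IH[of m] step[of m] show ?thesis by auto
    next
      case 2
      then show ?thesis by (auto simp: add_increasing2)
    qed auto
  qed
  then show thesis using that[of "min (h 1) (h 2)" "max (h 1) (h 2)"] by (auto simp: h_def)
qed

lemma stirling_error_half_over_n:
  "(\<lambda>n. stirling_error (real n / 2) / real n) \<longlonglongrightarrow> 0"
proof -
  obtain c C where b: "\<And>n. n \<ge> 1 \<Longrightarrow> c \<le> stirling_error (real n / 2)"
    "\<And>n. n \<ge> 1 \<Longrightarrow> stirling_error (real n / 2) \<le> C + ln (real n)"
    using stirling_error_half_bounds by metis
  show ?thesis
  proof (rule tendsto_sandwich)
    show "\<forall>\<^sub>F n in sequentially. c / real n \<le> stirling_error (real n / 2) / real n"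
      using eventually_ge_at_top[of 1] by eventually_elim (auto intro!: divide_right_mono b)
    show "\<forall>\<^sub>F n in sequentially. stirling_error (real n / 2) / real n \<le> (C + ln (real n)) / real n"
      using eventually_ge_at_top[of 1] by eventually_elim (auto intro!: divide_right_mono b)
    show "(\<lambda>n. c / real n) \<longlonglongrightarrow> 0" by real_asymp
    show "(\<lambda>n. (C + ln (real n)) / real n) \<longlonglongrightarrow> 0" by real_asymp
  qed
qed

section \<open>Asymptotics of \<open>GH\<close> and of the parameter sequences\<close>

lemma GH_pos: "GH n > 0"
  unfolding GH_def powr_gt_zero using unit_ball_vol_pos[of "real n"] by linarith

text \<open>With k = n/2, the volume formula makes the left side equal to Gamma(k + 1) to the power
  1/k. Writing \<open>ln (Gamma (k + 1))\<close> as k ln k - k plus the Stirling error and dividing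
  by k leaves k/e times a correction factor, which tends to 1.\<close>

lemma pi_GH_squared:
  assumes "n \<ge> 1"
  shows "pi * (GH n)\<^sup>2 = real n / 2 * exp (2 * (stirling_error (real n / 2) / real n) - 1)"
proof -
  have n: "real n > 0" using assms by simp
  have G: "Gamma (real n / 2 + 1) > 0" by (intro Gamma_real_pos) auto
  have v: "unit_ball_vol (real n) > 0" by simp
  \<comment> \<open>The logarithms are replaced by free variables, so that the identity is plain
    field arithmetic: \<open>a\<close> stands for \<open>ln pi\<close>, \<open>L\<close> for
    \<open>ln (n / 2)\<close> and \<open>S\<close> for the Stirling error.\<close>
  have alg: "a - 2 / N * (N / 2 * a - (N / 2 * L - N / 2 + S)) = L + (2 * (S / N) - 1)"
    if "N > 0" for a L N S :: real
    using that by (simp add: field_simps)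
  have "ln (unit_ball_vol (real n)) = real n / 2 * ln pi - ln (Gamma (real n / 2 + 1))"
    unfolding unit_ball_vol_def using G by (subst ln_divide_pos) (auto simp: ln_powr)
  also have "ln (Gamma (real n / 2 + 1))
      = real n / 2 * ln (real n / 2) - real n / 2 + stirling_error (real n / 2)"
    unfolding stirling_error_def by simp
  finally have lnv: "ln (unit_ball_vol (real n)) = real n / 2 * ln pi
      - (real n / 2 * ln (real n / 2) - real n / 2 + stirling_error (real n / 2))" .
  have "ln (GH n) = - (1 / real n) * ln (unit_ball_vol (real n))"
    unfolding GH_def using v by (subst ln_powr) auto
  moreover have "ln (pi * (GH n)\<^sup>2) = ln pi + 2 * ln (GH n)"
    using GH_pos[of n] by (simp add: ln_mult_pos ln_realpow)
  ultimately have "ln (pi * (GH n)\<^sup>2) = ln pi - 2 / real n * ln (unit_ball_vol (real n))"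
    by simp
  also have "\<dots> = ln (real n / 2) + (2 * (stirling_error (real n / 2) / real n) - 1)"
    unfolding lnv using n by (rule alg)
  finally have "ln (pi * (GH n)\<^sup>2)
      = ln (real n / 2) + (2 * (stirling_error (real n / 2) / real n) - 1)" .
  then have "exp (ln (pi * (GH n)\<^sup>2))
      = exp (ln (real n / 2)) * exp (2 * (stirling_error (real n / 2) / real n) - 1)"
    by (simp only: exp_add)
  then show ?thesis using n GH_pos[of n] by simp
qed

lemma pi_GH_squared_over_n: "(\<lambda>n. pi * (GH n)\<^sup>2 / real n) \<longlonglongrightarrow> 1 / (2 * exp 1)"
proof -
  have lim: "(\<lambda>n. exp (2 * (stirling_error (real n / 2) / real n) - 1) / 2) \<longlonglongrightarrow> exp (2 * 0 - 1) / 2"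
    by (intro tendsto_intros stirling_error_half_over_n) auto
  have val: "exp (2 * 0 - 1) / 2 = 1 / (2 * exp (1::real))"
    by (simp add: exp_minus field_simps)
  have ev: "\<forall>\<^sub>F n in sequentially.
      exp (2 * (stirling_error (real n / 2) / real n) - 1) / 2 = pi * (GH n)\<^sup>2 / real n"
    using eventually_ge_at_top[of 1] by eventually_elim (simp add: pi_GH_squared)
  show ?thesis using Lim_transform_eventually[OF lim ev] unfolding val .
qed

text \<open>This limit explains the range of \<gamma>: since \<open>rho_seq \<gamma>\<close> tends
  to \<gamma>, the strict bound by sqrt e puts it below \<open>alpha_seq\<close> eventually.\<close>

lemma alpha_seq_tendsto: "alpha_seq \<longlonglongrightarrow> sqrt (exp 1)"
proof -
  have "(\<lambda>n. sqrt (1 / (2 * (pi * (GH n)\<^sup>2 / real n)))) \<longlonglongrightarrow> sqrt (1 / (2 * (1 / (2 * exp 1))))"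
    by (intro tendsto_intros pi_GH_squared_over_n) auto
  moreover have "sqrt (1 / (2 * (pi * (GH n)\<^sup>2 / real n))) = alpha_seq n" for n
    using GH_pos[of n] by (simp add: alpha_seq_def real_sqrt_divide real_sqrt_mult)
  ultimately show ?thesis by simp
qed

lemma R_seq_tendsto: "R_seq \<longlonglongrightarrow> 1"
  unfolding R_seq_def by real_asymp

lemma kappa_seq_tendsto: "kappa_seq \<longlonglongrightarrow> 1"
  unfolding kappa_seq_def by real_asymp

section \<open>The zeta function at large integers, and the error term
  \<open>E_plus_seq\<close>\<close>

text \<open>For b \<ge> 2, splitting off two of the n factors bounds b^(-n) by 2^(-(n-2)) b^(-2).
  Summing over b compares the tail with that of zeta(2), which explains the constant 4. The
  exponential decay of zeta(n) - 1 is what makes \<open>M2_seq\<close> negligible.\<close>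

lemma riemann_zeta_bounds:
  assumes "n \<ge> 2"
  shows "1 \<le> riemann_zeta (real n)" "riemann_zeta (real n) \<le> 1 + 4 * riemann_zeta 2 / 2 ^ n"
proof -
  define f where "f s m = 1 / real (Suc m) powr s" for s :: real and m
  have summ: "summable (f s)" if "s > 1" for s
  proof -
    have "summable (\<lambda>n. real n powr (- s))" using that by (simp add: summable_real_powr_iff)
    then have "summable (\<lambda>n. real (Suc n) powr (- s))" by (subst summable_Suc_iff)
    then show ?thesis unfolding f_def by (simp add: powr_minus_divide)
  qed
  have z: "riemann_zeta s = suminf (f s)" for s unfolding riemann_zeta_def f_def ..
  have split: "riemann_zeta s = 1 + (\<Sum>m. f s (Suc m))" if "s > 1" for s
    using suminf_split_head[OF summ[OF that]] unfolding z by (simp add: f_def)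
  have nn: "f s m \<ge> 0" for s m unfolding f_def by simp
  have n1: "real n > 1" using assms by simp
  have s2: "summable (f 2)" and sn: "summable (f (real n))" using n1 by (auto intro: summ)
  have s2': "summable (\<lambda>m. f 2 (Suc m))" and sn': "summable (\<lambda>m. f (real n) (Suc m))"
    using s2 sn by (auto simp: summable_Suc_iff)
  show "1 \<le> riemann_zeta (real n)"
    using split[OF n1] suminf_nonneg[OF sn'] nn by simp
  have le: "f (real n) (Suc m) \<le> 4 / 2 ^ n * f 2 (Suc m)" for m
  proof -
    let ?b = "real (Suc (Suc m))"
    obtain j where j: "n = j + 2" using assms by (metis le_add_diff_inverse2)
    have "(2::real) ^ j \<le> ?b ^ j" by (intro power_mono) auto
    then have "1 / ?b ^ j \<le> 1 / 2 ^ j" by (intro divide_left_mono) auto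
    then have "1 / ?b ^ j * (1 / ?b\<^sup>2) \<le> 1 / 2 ^ j * (1 / ?b\<^sup>2)"
      by (intro mult_right_mono) auto
    moreover have "f (real n) (Suc m) = 1 / ?b ^ j * (1 / ?b\<^sup>2)"
      unfolding f_def by (subst powr_realpow) (auto simp: j power_add power2_eq_square)
    moreover have "f 2 (Suc m) = 1 / ?b\<^sup>2"
      unfolding f_def by (simp only: powr_numeral of_nat_0_le_iff)
    moreover have "(4::real) / 2 ^ n = 1 / 2 ^ j" by (simp add: j power_add)
    ultimately show ?thesis by simp
  qed
  have "(\<Sum>m. f (real n) (Suc m)) \<le> (\<Sum>m. 4 / 2 ^ n * f 2 (Suc m))"
    by (intro suminf_le le sn' summable_mult s2')
  also have "\<dots> = 4 / 2 ^ n * (\<Sum>m. f 2 (Suc m))" by (intro suminf_mult s2')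
  also have "\<dots> \<le> 4 / 2 ^ n * riemann_zeta 2"
    using split[of 2] by (intro mult_left_mono) auto
  finally show "riemann_zeta (real n) \<le> 1 + 4 * riemann_zeta 2 / 2 ^ n"
    using split[OF n1] by simp
qed

lemma riemann_zeta_tendsto: "(\<lambda>n. riemann_zeta (real n)) \<longlonglongrightarrow> 1"
proof (rule tendsto_sandwich)
  show "\<forall>\<^sub>F n in sequentially. 1 \<le> riemann_zeta (real n)"
    using eventually_ge_at_top[of 2] by eventually_elim (rule riemann_zeta_bounds)
  show "\<forall>\<^sub>F n in sequentially. riemann_zeta (real n) \<le> 1 + 4 * riemann_zeta 2 / 2 ^ n"
    using eventually_ge_at_top[of 2] by eventually_elim (rule riemann_zeta_bounds)
  show "(\<lambda>n. 1 + 4 * riemann_zeta 2 / 2 ^ n) \<longlonglongrightarrow> 1" by real_asymp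
qed simp

text \<open>For n \<ge> 1 the nth powers are exact: \<open>kappa_seq n ^ n\<close> is 1/n and
  \<open>R_seq n ^ n\<close> is n. So all three terms are of order 1/n.\<close>

lemma E_plus_seq_tendsto: "E_plus_seq \<longlonglongrightarrow> 0"
proof -
  have lim: "(\<lambda>n. 1 / real n + (1 / real n) / (2 * riemann_zeta (real n))
      + 2 * riemann_zeta (real n) * (1 / real n)) \<longlonglongrightarrow> 0 + 0 / (2 * 1) + 2 * 1 * 0"
    by (intro tendsto_intros riemann_zeta_tendsto lim_1_over_n) auto
  have ev: "\<forall>\<^sub>F n in sequentially. 1 / real n + (1 / real n) / (2 * riemann_zeta (real n))
      + 2 * riemann_zeta (real n) * (1 / real n) = E_plus_seq n"
    using eventually_ge_at_top[of 1]
  proof eventually_elim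
    case (elim n)
    have "(real n powr a) ^ n = real n powr (a * real n)" for a
      using elim by (subst powr_realpow[symmetric]) (auto simp: powr_powr)
    from this[of "- (1 / real n)"] this[of "1 / real n"]
    have "kappa_seq n ^ n = 1 / real n" "R_seq n ^ n = real n"
      using elim unfolding kappa_seq_def R_seq_def by (simp_all add: powr_minus_divide)
    then show ?case by (simp add: E_plus_seq_def eta_seq_def)
  qed
  show ?thesis using Lim_transform_eventually[OF lim ev] by simp
qed

section \<open>The integrand of the incomplete gamma function and its exponential rate\<close>

definition gamma_density :: "real \<Rightarrow> real \<Rightarrow> real" where
  "gamma_density k t = t powr (k - 1) * exp (- t)"

text \<open>The logarithmic derivative (k - 1)/t - 1 is nonnegative up to the mode k - 1. The proof
  replaces differentiation by ln(s/t) \<le> s/t - 1.\<close>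

lemma gamma_density_mono:
  assumes "0 \<le> s" "s \<le> t" "t \<le> k - 1"
  shows "gamma_density k s \<le> gamma_density k t"
\<comment> \<open>At s = 0 the left side is 0, because \<open>0 powr a = 0\<close> for every
  \<open>a\<close>; this case is separated since the main argument uses \<open>ln s\<close>.\<close>
proof (cases "s = 0 \<or> s = t")
  case True
  then show ?thesis by (auto simp: gamma_density_def)
next
  case False
  then have s: "s > 0" "t > 0" using assms by auto
  have "ln s - ln t \<le> s / t - 1"
    using ln_le_minus_one[of "s / t"] s by (simp add: ln_div)
  then have "(t - s) / t \<le> ln t - ln s" using s by (simp add: field_simps)
  then have "t * ((t - s) / t) \<le> t * (ln t - ln s)" using s by (intro mult_left_mono) auto
  moreover have "t * ((t - s) / t) = t - s" using s by simp
  ultimately have "t - s \<le> t * (ln t - ln s)" by simp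
  also have "t * (ln t - ln s) \<le> (k - 1) * (ln t - ln s)"
    using s assms by (intro mult_right_mono) auto
  finally have "(k - 1) * ln s - s \<le> (k - 1) * ln t - t" using s by (simp add: algebra_simps)
  then have "exp ((k - 1) * ln s - s) \<le> exp ((k - 1) * ln t - t)" by simp
  then show ?thesis using s by (simp add: gamma_density_def powr_def exp_diff exp_minus divide_inverse)
qed

text \<open>The integrand increases on [y, x]. The lower bound keeps only [x - 1, x] and takes the
  value at its left end; the upper bound takes the value at x and enlarges the length x - y to
  x.\<close>

lemma P_gamma_diff_bounds:
  assumes "0 \<le> y" "y \<le> x - 1" "x \<le> k - 1"
  shows "gamma_density k (x - 1) / Gamma k \<le> P_gamma k x - P_gamma k y"
    and "P_gamma k x - P_gamma k y \<le> x * (gamma_density k x / Gamma k)"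
proof -
  have k: "k > 1" using assms by simp
  \<comment> \<open>The exponent k - 1 is positive, which gives continuity at 0 as well.\<close>
  have cont: "continuous_on S (gamma_density k)" if "S \<subseteq> {0..}" for S
    unfolding gamma_density_def using k that
    by (intro continuous_intros continuous_on_powr') auto
  have int: "gamma_density k integrable_on {a..b}" if "0 \<le> a" for a b
    using that by (intro integrable_continuous_interval cont) auto
  have split: "integral {a..b} (gamma_density k) + integral {b..c} (gamma_density k)
      = integral {a..c} (gamma_density k)" if "0 \<le> a" "a \<le> b" "b \<le> c" for a b c
    using that by (intro Henstock_Kurzweil_Integration.integral_combine int) auto
  have nonneg: "gamma_density k t \<ge> 0" for t by (simp add: gamma_density_def)
  have G: "Gamma k > 0" using k by (intro Gamma_real_pos) auto
  have P_gamma_eq: "P_gamma k u = integral {0..u} (gamma_density k) / Gamma k" for u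
    by (simp add: P_gamma_def gamma_density_def[abs_def])
  have P: "P_gamma k x - P_gamma k y = integral {y..x} (gamma_density k) / Gamma k"
    using split[of 0 y x] assms
    by (simp add: P_gamma_eq diff_divide_distrib[symmetric])
  have "gamma_density k (x - 1) = integral {x - 1..x} (\<lambda>_. gamma_density k (x - 1))" by simp
  also have "\<dots> \<le> integral {x - 1..x} (gamma_density k)"
    using assms by (intro integral_le int gamma_density_mono) auto
  also have "\<dots> \<le> integral {y..x} (gamma_density k)"
    using assms by (intro integral_subset_le int) (auto simp: nonneg)
  finally show "gamma_density k (x - 1) / Gamma k \<le> P_gamma k x - P_gamma k y"
    unfolding P using G by (simp add: divide_right_mono)
  have "integral {y..x} (gamma_density k) \<le> integral {y..x} (\<lambda>_. gamma_density k x)"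
    using assms by (intro integral_le int gamma_density_mono) auto
  also have "\<dots> = (x - y) * gamma_density k x" using assms by simp
  also have "\<dots> \<le> x * gamma_density k x"
    using assms nonneg by (intro mult_right_mono) auto
  finally show "P_gamma k x - P_gamma k y \<le> x * (gamma_density k x / Gamma k)"
    unfolding P using G by (simp add: divide_right_mono)
qed

text \<open>After Gamma(n/2) is rewritten as Gamma(n/2 + 1)/(n/2) and expressed by the Stirling
  error, the terms in n ln n cancel and only the ratio x/n survives in the limit. A general sequence
  \<open>x\<close> is allowed because the rate is needed both at the upper limit of integration and
  one unit before it.\<close>

lemma gamma_density_rate:
  assumes z: "(\<lambda>n. x n / real n) \<longlonglongrightarrow> z" and "z > 0"
  shows "(\<lambda>n. ln (gamma_density (real n / 2) (x n) / Gamma (real n / 2)) / real n)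
    \<longlonglongrightarrow> (1 + ln (2 * z)) / 2 - z"
proof -
  let ?h = "\<lambda>n. stirling_error (real n / 2)"
  have alg: "(1/2 - 1 / N) * (lx - lN) - x / N + (1 + l2) / 2 - l2 / N - S / N
      = ((N / 2 - 1) * lx - x - (N / 2 * (lN - l2) - N / 2 + S - (lN - l2))) / N"
    if "N > 0" for N lx lN x l2 S :: real
    using that by (simp add: field_simps)
  have lim: "(\<lambda>n. (1/2 - 1 / real n) * ln (x n / real n) - x n / real n + (1 + ln 2) / 2
      - ln 2 / real n - ?h n / real n) \<longlonglongrightarrow> (1/2 - 0) * ln z - z + (1 + ln 2) / 2 - 0 - 0"
    using assms(2)
    by (intro tendsto_intros z stirling_error_half_over_n lim_1_over_n lim_const_over_n) auto
  have val: "(1/2 - 0) * ln z - z + (1 + ln 2) / 2 - 0 - 0 = (1 + ln (2 * z)) / 2 - z"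
    using assms(2) by (simp add: ln_mult field_simps)
  have ev: "\<forall>\<^sub>F n in sequentially. (1/2 - 1 / real n) * ln (x n / real n) - x n / real n
      + (1 + ln 2) / 2 - ln 2 / real n - ?h n / real n
      = ln (gamma_density (real n / 2) (x n) / Gamma (real n / 2)) / real n"
    using eventually_ge_at_top[of 1] order_tendstoD(1)[OF z assms(2)]
  proof eventually_elim
    case (elim n)
    then have n: "real n > 0" and xn: "x n > 0" by (auto simp: zero_less_divide_iff)
    have G: "Gamma (real n / 2) > 0" using n by (intro Gamma_real_pos) auto
    have "Gamma (real n / 2 + 1) = real n / 2 * Gamma (real n / 2)"
      using n by (intro Gamma_plus1) (auto elim!: nonpos_Ints_cases)
    then have "ln (Gamma (real n / 2 + 1)) = ln (real n / 2) + ln (Gamma (real n / 2))"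
      using G n by (simp only: ln_mult_pos half_gt_zero)
    then have lnG: "ln (Gamma (real n / 2))
        = real n / 2 * ln (real n / 2) - real n / 2 + ?h n - ln (real n / 2)"
      unfolding stirling_error_def by simp
    have "ln (gamma_density (real n / 2) (x n) / Gamma (real n / 2))
        = (real n / 2 - 1) * ln (x n) - x n - ln (Gamma (real n / 2))"
      unfolding gamma_density_def using G xn
      by (subst ln_divide_pos) (auto simp: ln_mult_pos ln_powr)
    then show ?case
      unfolding lnG using alg[OF n] n xn by (simp only: ln_divide_pos zero_less_numeral)
  qed
  show ?thesis using Lim_transform_eventually[OF lim ev] unfolding val .
qed

text \<open>With u = \<gamma>^2/e in (0,1) the rate is (u - 1 - ln u)/2, positive because ln u < u -
  1 for u \<noteq> 1. Dropping ln \<gamma> \<ge> 0 bounds it by u/2 < 1/2 < ln 2. Positivity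
  resolves the minimum in \<open>U_seq\<close>; the bound by ln 2 makes \<open>M1_seq\<close>
  dominate \<open>M2_seq\<close>.\<close>

lemma rate_less_ln2:
  fixes \<gamma> :: real
  assumes "1 \<le> \<gamma>" "\<gamma> < sqrt (exp 1)"
  shows "0 < \<gamma>\<^sup>2 / (2 * exp 1) - ln \<gamma>" "\<gamma>\<^sup>2 / (2 * exp 1) - ln \<gamma> < ln 2"
proof -
  define u where "u = \<gamma>\<^sup>2 / exp 1"
  have "\<gamma>\<^sup>2 < (sqrt (exp 1))\<^sup>2" using assms by (intro power_strict_mono) auto
  then have u: "0 < u" "u < 1" using assms by (auto simp: u_def)
  have "ln u = 2 * ln \<gamma> - 1"
    unfolding u_def using assms by (subst ln_divide_pos) (auto simp: ln_realpow)
  moreover have "ln u < u - 1"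
    using ln_le_minus_one[of u] ln_eq_minus_one[of u] u by fastforce
  moreover have L: "\<gamma>\<^sup>2 / (2 * exp 1) = u / 2" by (simp add: u_def)
  ultimately show "0 < \<gamma>\<^sup>2 / (2 * exp 1) - ln \<gamma>" by simp
  have "\<gamma>\<^sup>2 / (2 * exp 1) - ln \<gamma> \<le> u / 2" using L assms by simp
  also have "\<dots> < ln 2" using u ln2_ge_two_thirds by simp
  finally show "\<gamma>\<^sup>2 / (2 * exp 1) - ln \<gamma> < ln 2" .
qed

section \<open>Bounds for \<open>M1_seq\<close> and \<open>M2_seq\<close>\<close>

lemma incomplete_gamma_upper_limit_over_n:
  "(\<lambda>n. pi * (rho_seq \<gamma> n)\<^sup>2 * (GH n)\<^sup>2 / real n) \<longlonglongrightarrow> \<gamma>\<^sup>2 / (2 * exp 1)"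
proof -
  have "(\<lambda>n. (\<gamma> * R_seq n)\<^sup>2 * (pi * (GH n)\<^sup>2 / real n)) \<longlonglongrightarrow> (\<gamma> * 1)\<^sup>2 * (1 / (2 * exp 1))"
    by (intro tendsto_intros R_seq_tendsto pi_GH_squared_over_n)
  then show ?thesis by (simp add: rho_seq_def mult_ac)
qed

text \<open>The factor 1/2 absorbs zeta(n) < 2, and the factor n replaces the length bound x \<le>
  n/2 - 1.\<close>

lemma M1_seq_bounds:
  fixes \<gamma> :: real
  assumes "1 \<le> \<gamma>" "\<gamma> < sqrt (exp 1)"
  defines "x \<equiv> \<lambda>n. pi * (rho_seq \<gamma> n)\<^sup>2 * (GH n)\<^sup>2"
    and "A \<equiv> \<lambda>n t. gamma_density (real n / 2) t / Gamma (real n / 2)"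
  shows "\<forall>\<^sub>F n in sequentially. A n (x n - 1) / 2 \<le> M1_seq \<gamma> n \<and> M1_seq \<gamma> n \<le> real n * A n (x n)"
proof -
  let ?y = "\<lambda>n. pi * (kappa_seq n)\<^sup>2 * (GH n)\<^sup>2"
  have g2: "\<gamma>\<^sup>2 \<ge> 1" using assms by simp
  have "\<gamma>\<^sup>2 < (sqrt (exp 1))\<^sup>2" using assms by (intro power_strict_mono) auto
  then have less: "\<gamma>\<^sup>2 / (2 * exp 1) < 1 / 2" by simp
  \<comment> \<open>The gap between \<gamma>^2/(2e) and 1/2 is strict, so it absorbs the shift 1/n
    and places x left of the mode n/2 - 1.\<close>
  have lim: "(\<lambda>n. x n / real n - (1 / 2 - 1 / real n)) \<longlonglongrightarrow> \<gamma>\<^sup>2 / (2 * exp 1) - (1 / 2 - 0)"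
    unfolding x_def by (intro tendsto_intros incomplete_gamma_upper_limit_over_n lim_1_over_n)
  have "\<forall>\<^sub>F n in sequentially. x n / real n - (1 / 2 - 1 / real n) < 0"
    by (rule order_tendstoD(2)[OF lim]) (use less in simp)
  then have ev1: "\<forall>\<^sub>F n in sequentially. x n \<le> real n / 2 - 1"
    using eventually_gt_at_top[of 0] by eventually_elim (simp add: field_simps)
  \<comment> \<open>The difference of squares is asymptotic to 4 ln n / n. Hence the interval of
    integration has length at least of order ln n, already for \<gamma> = 1, and eventually contains
    a unit interval.\<close>
  have "filterlim (\<lambda>n. real n * ((R_seq n)\<^sup>2 - (kappa_seq n)\<^sup>2)) at_top sequentially"
    unfolding R_seq_def kappa_seq_def by real_asymp
  then have "filterlim (\<lambda>n. pi * (GH n)\<^sup>2 / real n * (real n * ((R_seq n)\<^sup>2 - (kappa_seq n)\<^sup>2)))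
      at_top sequentially"
    by (rule filterlim_tendsto_pos_mult_at_top[OF pi_GH_squared_over_n, rotated]) simp
  then have "\<forall>\<^sub>F n in sequentially.
      1 \<le> pi * (GH n)\<^sup>2 / real n * (real n * ((R_seq n)\<^sup>2 - (kappa_seq n)\<^sup>2))"
    by (simp add: filterlim_at_top)
  then have ev2: "\<forall>\<^sub>F n in sequentially. ?y n \<le> x n - 1"
    using eventually_gt_at_top[of 0]
  proof eventually_elim
    case (elim n)
    have "1 \<le> pi * (GH n)\<^sup>2 * ((R_seq n)\<^sup>2 - (kappa_seq n)\<^sup>2)" using elim by simp
    also have "\<dots> \<le> pi * (GH n)\<^sup>2 * ((rho_seq \<gamma> n)\<^sup>2 - (kappa_seq n)\<^sup>2)"
      using mult_right_mono[OF g2, of "(R_seq n)\<^sup>2"]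
      by (intro mult_left_mono) (auto simp: rho_seq_def power_mult_distrib)
    finally show ?case by (simp add: x_def algebra_simps)
  qed
  have ev3: "\<forall>\<^sub>F n in sequentially. riemann_zeta (real n) < 2"
    by (rule order_tendstoD(2)[OF riemann_zeta_tendsto]) simp
  show ?thesis
    using ev1 ev2 ev3 eventually_ge_at_top[of 2]
  proof eventually_elim
    case (elim n)
    have n: "real n \<ge> 2" using elim by simp
    have z: "1 \<le> riemann_zeta (real n)" using elim by (intro riemann_zeta_bounds)
    have y: "0 \<le> ?y n" by simp
    then have x_nonneg: "0 \<le> x n" using elim(2) by linarith
    note bounds = P_gamma_diff_bounds[OF y elim(2,1)]
    have A: "0 \<le> A n t" for t
      unfolding A_def gamma_density_def using n by (intro divide_nonneg_pos Gamma_real_pos) auto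
    have M1: "M1_seq \<gamma> n
        = (P_gamma (real n / 2) (x n) - P_gamma (real n / 2) (?y n)) / riemann_zeta (real n)"
      by (simp add: M1_seq_def Let_def x_def)
    have "A n (x n - 1) / 2 \<le> A n (x n - 1) / riemann_zeta (real n)"
      using z elim A[of "x n - 1"] by (intro divide_left_mono) auto
    also have "\<dots> \<le> M1_seq \<gamma> n"
      unfolding M1 A_def using bounds(1) z by (intro divide_right_mono) auto
    finally have lower: "A n (x n - 1) / 2 \<le> M1_seq \<gamma> n" .
    have "M1_seq \<gamma> n \<le> x n * A n (x n) / riemann_zeta (real n)"
      unfolding M1 A_def using bounds(2) z by (intro divide_right_mono) auto
    also have "\<dots> \<le> x n * A n (x n) / 1"
      using z A[of "x n"] x_nonneg by (intro divide_left_mono mult_nonneg_nonneg) auto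
    also have "\<dots> \<le> real n * A n (x n)"
      using A[of "x n"] elim n by (simp add: mult_right_mono)
    finally show ?case using lower by simp
  qed
qed

text \<open>The quotient of (k/e)^k by Gamma(k + 1) is exp of minus the Stirling error, hence
  bounded. The zeta factor is of order 2^(-n), and the logarithm equals ln \<gamma> + 2 ln n / n, at
  most ln \<gamma> + 1 eventually. The constant \<open>D\<close> is the product of these three
  bounds.\<close>

lemma M2_seq_bounds:
  assumes "1 \<le> \<gamma>"
  obtains D where "D > 0" "\<forall>\<^sub>F n in sequentially. 0 \<le> M2_seq \<gamma> n \<and> M2_seq \<gamma> n \<le> D * (real n / 2 ^ n)"
proof -
  obtain c C where c: "\<And>n. n \<ge> 1 \<Longrightarrow> c \<le> stirling_error (real n / 2)"
    using stirling_error_half_bounds by metis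
  define D where "D = exp (- c) * (4 * riemann_zeta 2) * (ln \<gamma> + 1)"
  have z2: "riemann_zeta 2 \<ge> 1" using riemann_zeta_bounds(1)[of 2] by simp
  have D: "D > 0" unfolding D_def using assms z2 by (intro mult_pos_pos) (auto intro: add_nonneg_pos)
  have "\<forall>\<^sub>F n in sequentially. 2 * ln (real n) / real n \<le> 1" by real_asymp
  then have "\<forall>\<^sub>F n in sequentially. 0 \<le> M2_seq \<gamma> n \<and> M2_seq \<gamma> n \<le> D * (real n / 2 ^ n)"
    using eventually_ge_at_top[of 2]
  proof eventually_elim
    case (elim n)
    have n: "real n > 0" "real n \<ge> 1" using elim by auto
    have G: "Gamma (real n / 2 + 1) > 0" by (intro Gamma_real_pos) auto
    define S where "S = (real n / 2 / exp 1) powr (real n / 2) / Gamma (real n / 2 + 1)"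
    define Z where "Z = (riemann_zeta (real n) - 1) / riemann_zeta (real n)"
    define l where "l = ln (rho_seq \<gamma> n / kappa_seq n)"
    have M2: "M2_seq \<gamma> n = real n * S * Z * l"
      by (simp add: M2_seq_def Let_def S_def Z_def l_def)
    have ln_base: "ln (real n / 2 / exp 1) = ln (real n / 2) - 1"
      using ln_divide_pos[of "real n / 2" "exp 1"] n by simp
    have "ln S = real n / 2 * ln (real n / 2 / exp 1) - ln (Gamma (real n / 2 + 1))"
      unfolding S_def using G n by (subst ln_divide_pos) (auto simp: ln_powr)
    then have lnS: "ln S = - stirling_error (real n / 2)"
      unfolding ln_base stirling_error_def right_diff_distrib by linarith
    have S_pos: "S > 0" unfolding S_def using n G by simp
    have "exp (ln S) \<le> exp (- c)" using c[of n] elim lnS by simp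
    with S_pos have S: "0 \<le> S" "S \<le> exp (- c)" by simp_all
    have zn: "1 \<le> riemann_zeta (real n)" "riemann_zeta (real n) \<le> 1 + 4 * riemann_zeta 2 / 2 ^ n"
      using riemann_zeta_bounds[of n] elim by auto
    have "Z \<le> (riemann_zeta (real n) - 1) / 1"
      unfolding Z_def using zn by (intro divide_left_mono) auto
    with zn have Z: "0 \<le> Z" "Z \<le> 4 * riemann_zeta 2 / 2 ^ n" by (auto simp: Z_def)
    have "rho_seq \<gamma> n > 0" "kappa_seq n > 0"
      using n assms by (auto simp: rho_seq_def R_seq_def kappa_seq_def)
    then have "l = ln (rho_seq \<gamma> n) - ln (kappa_seq n)"
      unfolding l_def by (rule ln_divide_pos)
    also have "ln (kappa_seq n) = - (ln (real n) / real n)"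
      unfolding kappa_seq_def using n by (subst ln_powr) auto
    also have "ln (rho_seq \<gamma> n) = ln \<gamma> + ln (R_seq n)"
      unfolding rho_seq_def using n assms by (subst ln_mult_pos) (auto simp: R_seq_def)
    also have "ln (R_seq n) = ln (real n) / real n"
      unfolding R_seq_def using n by (subst ln_powr) auto
    finally have l_eq: "l = ln \<gamma> + 2 * ln (real n) / real n" by simp
    have l: "0 \<le> l" "l \<le> ln \<gamma> + 1" using elim n assms by (auto simp: l_eq)
    have "S * Z * l \<le> exp (- c) * (4 * riemann_zeta 2 / 2 ^ n) * (ln \<gamma> + 1)"
      using S Z l by (intro mult_mono mult_nonneg_nonneg) auto
    then have "real n * (S * Z * l)
        \<le> real n * (exp (- c) * (4 * riemann_zeta 2 / 2 ^ n) * (ln \<gamma> + 1))"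
      using n by (intro mult_left_mono) auto
    then show ?case unfolding M2 using S Z l n by (simp add: D_def mult_ac)
  qed
  with D show thesis by (rule that)
qed

section \<open>Parameter conditions and the exponential rate of \<open>U_seq\<close>\<close>

theorem corollary4p8:
  fixes \<gamma> :: real
  assumes "1 \<le> \<gamma>" and "\<gamma> < sqrt (exp 1)"
  shows "(\<forall>\<^sub>F n in sequentially.
            0 < eta_seq n \<and> eta_seq n < 1 \<and>
            0 < kappa_seq n \<and> kappa_seq n < 1 \<and> 1 < R_seq n \<and>
            alpha_seq n / 2 \<le> kappa_seq n \<and> rho_seq \<gamma> n \<le> alpha_seq n)
       \<and> E_plus_seq \<longlonglongrightarrow> 0
       \<and> (\<lambda>n. - (1 / real n) * ln (U_seq \<gamma> n)) \<longlonglongrightarrow> \<gamma>\<^sup>2 / (2 * exp 1) - ln \<gamma>"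
proof (intro conjI)
  \<comment> \<open>\<open>alpha_seq n / 2\<close> tends to (sqrt e)/2 and \<open>kappa_seq\<close>
    to 1, so this strict inequality settles their order for large n.\<close>
  have "sqrt (exp 1) < 2"
    by (rule real_less_lsqrt) (use exp_le in auto)
  then have 1: "\<forall>\<^sub>F n in sequentially. alpha_seq n / 2 - kappa_seq n < 0"
    by (intro order_tendstoD(2)[OF tendsto_diff[OF tendsto_divide[OF alpha_seq_tendsto tendsto_const]
          kappa_seq_tendsto]]) auto
  have "(\<lambda>n. \<gamma> * R_seq n - alpha_seq n) \<longlonglongrightarrow> \<gamma> * 1 - sqrt (exp 1)"
    by (intro tendsto_intros R_seq_tendsto alpha_seq_tendsto)
  then have 2: "\<forall>\<^sub>F n in sequentially. \<gamma> * R_seq n - alpha_seq n < 0"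
    by (rule order_tendstoD(2)) (use assms in simp)
  have 3: "\<forall>\<^sub>F n in sequentially. kappa_seq n < 1" "\<forall>\<^sub>F n in sequentially. 1 < R_seq n"
    unfolding kappa_seq_def R_seq_def by real_asymp+
  show "\<forall>\<^sub>F n in sequentially.
            0 < eta_seq n \<and> eta_seq n < 1 \<and>
            0 < kappa_seq n \<and> kappa_seq n < 1 \<and> 1 < R_seq n \<and>
            alpha_seq n / 2 \<le> kappa_seq n \<and> rho_seq \<gamma> n \<le> alpha_seq n"
    using 1 2 3 eventually_ge_at_top[of 2]
    by eventually_elim (auto simp: eta_seq_def kappa_seq_def rho_seq_def)
  show "E_plus_seq \<longlonglongrightarrow> 0" by (rule E_plus_seq_tendsto)

  define L where "L = \<gamma>\<^sup>2 / (2 * exp 1) - ln \<gamma>"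
  have L: "0 < L" "L < ln 2" unfolding L_def using rate_less_ln2[OF assms] by auto
  define x where "x n = pi * (rho_seq \<gamma> n)\<^sup>2 * (GH n)\<^sup>2" for n
  define A where "A n t = gamma_density (real n / 2) t / Gamma (real n / 2)" for n :: nat and t
  define z where "z = \<gamma>\<^sup>2 / (2 * exp 1)"
  have z: "z > 0" unfolding z_def using assms by simp
  have "ln (2 * z) = ln (\<gamma>\<^sup>2 / exp 1)" by (simp add: z_def)
  also have "\<dots> = 2 * ln \<gamma> - 1"
    using assms by (subst ln_divide_pos) (auto simp: ln_realpow)
  finally have rate: "(1 + ln (2 * z)) / 2 - z = - L" by (simp add: L_def z_def)
  have x: "(\<lambda>n. x n / real n) \<longlonglongrightarrow> z"
    unfolding x_def z_def by (rule incomplete_gamma_upper_limit_over_n)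
  \<comment> \<open>Shifting by 1 does not change the limit of x/n, so the lower and upper bounds on
    \<open>M1_seq\<close> have the same rate.\<close>
  have "(\<lambda>n. x n / real n - 1 / real n) \<longlonglongrightarrow> z - 0"
    by (intro tendsto_diff x lim_1_over_n)
  then have x1: "(\<lambda>n. (x n - 1) / real n) \<longlonglongrightarrow> z"
    by (simp add: diff_divide_distrib)
  have A_upper: "(\<lambda>n. ln (A n (x n)) / real n) \<longlonglongrightarrow> - L"
    using gamma_density_rate[OF x z] unfolding rate A_def .
  have A_lower: "(\<lambda>n. ln (A n (x n - 1)) / real n) \<longlonglongrightarrow> - L"
    using gamma_density_rate[OF x1 z] unfolding rate A_def .
  have A_pos: "A n t > 0" if "n > 0" "t > 0" for n t
    unfolding A_def gamma_density_def using that by (intro divide_pos_pos Gamma_real_pos) auto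

  have M1: "\<forall>\<^sub>F n in sequentially. A n (x n - 1) / 2 \<le> M1_seq \<gamma> n \<and> M1_seq \<gamma> n \<le> real n * A n (x n)"
    using M1_seq_bounds[OF assms] unfolding A_def x_def .
  obtain D where D: "D > 0"
    and M2: "\<forall>\<^sub>F n in sequentially. 0 \<le> M2_seq \<gamma> n \<and> M2_seq \<gamma> n \<le> D * (real n / 2 ^ n)"
    using M2_seq_bounds[OF assms(1)] .
  \<comment> \<open>Comparison of exponents: D 2^(-n) has rate -ln 2 < -L, so it eventually falls
    below \<open>A n (x n)\<close>. Then \<open>M2_seq\<close> is at most n times that value, like
    \<open>M1_seq\<close>.\<close>
  have "(\<lambda>n. ln D / real n - ln 2) \<longlonglongrightarrow> - ln 2" by real_asymp
  then have "(\<lambda>n. ln (A n (x n)) / real n - (ln D / real n - ln 2)) \<longlonglongrightarrow> - L - (- ln 2)"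
    by (intro tendsto_diff A_upper)
  then have dom: "\<forall>\<^sub>F n in sequentially. 0 < ln (A n (x n)) / real n - (ln D / real n - ln 2)"
    by (rule order_tendstoD(1)) (use L in simp)

  \<comment> \<open>\<open>W\<close> is \<open>U_seq\<close> before the minimum with 1 is
    taken.\<close>
  define W where "W n = (M1_seq \<gamma> n + M2_seq \<gamma> n) / eta_seq n" for n
  have x1_pos: "\<forall>\<^sub>F n in sequentially. 0 < (x n - 1) / real n"
    by (rule order_tendstoD(1)[OF x1 z])
  \<comment> \<open>Dividing by \<open>eta_seq n\<close> multiplies by n. Below, this meets the 1/2
    from the bound on \<open>M1_seq\<close>; above, it meets 2n, as both terms are at most n
    \<open>A n (x n)\<close>. These polynomial factors vanish after taking logarithms and dividing
    by n.\<close>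
  have W: "\<forall>\<^sub>F n in sequentially. 0 < W n
      \<and> (ln (real n) - ln 2) / real n + ln (A n (x n - 1)) / real n \<le> ln (W n) / real n
      \<and> ln (W n) / real n \<le> (ln 2 + 2 * ln (real n)) / real n + ln (A n (x n)) / real n"
    using M1 M2 dom x1_pos eventually_gt_at_top[of 0]
  proof eventually_elim
    case (elim n)
    have n: "real n > 0" using elim by simp
    have xn: "x n - 1 > 0" using elim(4) n by (simp add: zero_less_divide_iff)
    have pos: "A n (x n) > 0" "A n (x n - 1) > 0" using A_pos xn elim(5) by auto
    have Weq: "W n = real n * (M1_seq \<gamma> n + M2_seq \<gamma> n)" by (simp add: W_def eta_seq_def)
    have "ln D - real n * ln 2 < ln (A n (x n))" using elim(3) n by (simp add: field_simps)
    then have "exp (ln D - real n * ln 2) < exp (ln (A n (x n)))" by simp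
    moreover have "exp (real n * ln 2) = (2::real) ^ n" by (simp add: exp_of_nat_mult)
    ultimately have "D / 2 ^ n < A n (x n)"
      using D pos by (simp add: exp_diff)
    then have "real n * (D / 2 ^ n) \<le> real n * A n (x n)" using n by (intro mult_left_mono) auto
    then have "M1_seq \<gamma> n + M2_seq \<gamma> n \<le> 2 * real n * A n (x n)"
      using elim(1,2) by (simp add: mult_ac)
    then have upper: "W n \<le> real n * (2 * real n * A n (x n))"
      unfolding Weq using n by (intro mult_left_mono) auto
    have "A n (x n - 1) / 2 \<le> M1_seq \<gamma> n + M2_seq \<gamma> n" using elim(1,2) by linarith
    then have lower: "real n * (A n (x n - 1) / 2) \<le> W n"
      unfolding Weq using n by (intro mult_left_mono) auto
    have lower_pos: "0 < real n * (A n (x n - 1) / 2)" using n pos by simp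
    then have W_pos: "0 < W n" using lower by linarith
    have "ln (real n * (A n (x n - 1) / 2)) = ln (real n) - ln 2 + ln (A n (x n - 1))"
      using n pos by (subst ln_mult_pos) (auto simp: ln_divide_pos)
    moreover have "ln (real n * (A n (x n - 1) / 2)) \<le> ln (W n)"
      using lower lower_pos by (rule ln_mono)
    ultimately have l: "ln (real n) - ln 2 + ln (A n (x n - 1)) \<le> ln (W n)" by linarith
    have "ln (real n * (2 * real n * A n (x n))) = ln 2 + 2 * ln (real n) + ln (A n (x n))"
      using n pos by (simp add: ln_mult_pos)
    moreover have "ln (W n) \<le> ln (real n * (2 * real n * A n (x n)))"
      using upper W_pos by (rule ln_mono)
    ultimately have u: "ln (W n) \<le> ln 2 + 2 * ln (real n) + ln (A n (x n))" by linarith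
    show ?case
      using W_pos divide_right_mono[OF l, of "real n"] divide_right_mono[OF u, of "real n"] n
      by (simp add: add_divide_distrib)
  qed
  have "(\<lambda>n. (ln (real n) - ln 2) / real n) \<longlonglongrightarrow> 0" by real_asymp
  from tendsto_add[OF this A_lower]
  have lo: "(\<lambda>n. (ln (real n) - ln 2) / real n + ln (A n (x n - 1)) / real n) \<longlonglongrightarrow> - L" by simp
  have "(\<lambda>n. (ln 2 + 2 * ln (real n)) / real n) \<longlonglongrightarrow> 0" by real_asymp
  from tendsto_add[OF this A_upper]
  have up: "(\<lambda>n. (ln 2 + 2 * ln (real n)) / real n + ln (A n (x n)) / real n) \<longlonglongrightarrow> - L" by simp
  have lnW: "(\<lambda>n. ln (W n) / real n) \<longlonglongrightarrow> - L"
    by (rule tendsto_sandwich[OF _ _ lo up]; use W in eventually_elim; simp)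
  \<comment> \<open>Since L > 0, \<open>W n\<close> is eventually below 1, so the minimum in
    \<open>U_seq\<close> is \<open>W n\<close> itself.\<close>
  have "\<forall>\<^sub>F n in sequentially. ln (W n) / real n < 0"
    by (rule order_tendstoD(2)[OF lnW]) (use L in simp)
  then have ev: "\<forall>\<^sub>F n in sequentially. - (ln (W n) / real n) = - (1 / real n) * ln (U_seq \<gamma> n)"
    using W eventually_gt_at_top[of 0]
  proof eventually_elim
    case (elim n)
    then have "W n < 1" by (auto simp: divide_less_0_iff)
    then have "U_seq \<gamma> n = W n" by (simp add: U_seq_def W_def)
    then show ?case by simp
  qed
  have "(\<lambda>n. - (ln (W n) / real n)) \<longlonglongrightarrow> - (- L)" by (intro tendsto_minus lnW)
  from Lim_transform_eventually[OF this ev]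
  show "(\<lambda>n. - (1 / real n) * ln (U_seq \<gamma> n)) \<longlonglongrightarrow> \<gamma>\<^sup>2 / (2 * exp 1) - ln \<gamma>"
    by (simp add: L_def)
qed

end
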